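(* Let $p>1$ and let $X$ be a reflexive, $p$-convex K\"othe function space. Assume that $M_X\sim M_Y$ for every subspace $Y$ of $X$ generated by a sequence of disjointly supported vectors. Then the Kalton--Peck map $\mathscr K(x)=x\log\frac{|x|}{\|x\|}$ is disjointly singular on $X$.
   Context: Scalars are complex. A K\"othe function space $X$ over a ($\sigma$-finite) measure space is a Banach space of classes of measurable functions, contained in the space $L_0$ of all measurable functions, such that $|f|\le|g|$, $f\in L_0$, $g\in X$ imply $f\in X$ and $\|f\|\le\|g\|$. "Subspace generated by a sequence of disjointly supported vectors" means the closed linear span of an infinite sequence of nonzero vectors with pairwise disjoint supports. For $X$ a K\"othe function space, or a subspace of one generated by a disjoint sequence, $M_X(n)=\sup\{\|x_1+\dots+x_n\| : x_1,\dots,x_n \text{ pairwise disjointly supported vectors in the unit ball of } X\}$. For functions $f,g$ on $\mathbb N$, $f\sim g$ means $0<\liminf f(n)/g(n)\le\limsup f(n)/g(n)<\infty$. $\mathscr K:X\to L_0$, with $\mathscr K(0)=0$ and $\mathscr K(x)=0$ at points where $x=0$. A homogeneous map $\Omega:X\to L_0$ is trivial on a subspace $W\subset X$ if there are a linear map $\ell:W\to L_0$ and a constant $C$ with $\Omega(x)-\ell(x)\in X$ and $\|\Omega(x)-\ell(x)\|\le C\|x\|$ for all $x\in W$. $\Omega$ is disjointly singular if it is not trivial on any subspace generated by a sequence of disjointly supported vectors. *)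

theory Defs
  imports "HOL-Analysis.Analysis"
begin

text \<open>A class of measurable functions modulo almost everywhere equality is handled through its
  representatives: a space of classes is a set of functions closed under almost everywhere
  equality, its norm is a functional on representatives vanishing exactly on null functions, and
  identities between classes are stated almost everywhere.  Closure under almost everywhere
  equality, and invariance of the norm under it, are instances of the ideal property below.\<close>

locale koethe_function_space = sigma_finite_measure M
  for M :: "'a measure" +
  fixes X :: "('a \<Rightarrow> complex) set"
    and N :: "('a \<Rightarrow> complex) \<Rightarrow> real"
  assumes measurable_carrier: "X \<subseteq> borel_measurable M"
    and zero_closed: "(\<lambda>_. 0) \<in> X"
    and add_closed: "f \<in> X \<Longrightarrow> g \<in> X \<Longrightarrow> (\<lambda>t. f t + g t) \<in> X"
    and scale_closed: "f \<in> X \<Longrightarrow> (\<lambda>t. c * f t) \<in> X"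
    and norm_eq_0_iff: "f \<in> X \<Longrightarrow> N f = 0 \<longleftrightarrow> (AE t in M. f t = 0)"
    and norm_triangle: "f \<in> X \<Longrightarrow> g \<in> X \<Longrightarrow> N (\<lambda>t. f t + g t) \<le> N f + N g"
    and norm_scale: "f \<in> X \<Longrightarrow> N (\<lambda>t. c * f t) = cmod c * N f"
    and ideal: "g \<in> X \<Longrightarrow> f \<in> borel_measurable M \<Longrightarrow> (AE t in M. cmod (f t) \<le> cmod (g t))
      \<Longrightarrow> f \<in> X \<and> N f \<le> N g"
    and complete: "(\<And>n. F n \<in> X) \<Longrightarrow>
      (\<And>e. e > 0 \<Longrightarrow> \<exists>K. \<forall>m\<ge>K. \<forall>n\<ge>K. N (\<lambda>t. F m t - F n t) < e) \<Longrightarrow>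
      \<exists>f\<in>X. (\<lambda>n::nat. N (\<lambda>t. F n t - f t)) \<longlonglongrightarrow> 0"

text \<open>The dual of a seminormed space of complex functions on a type is again a space of complex
  functions on a type, so the bidual is obtained by iterating the same construction.  Functionals
  are total functions whose values outside \<open>V\<close> are irrelevant; boundedness identifies functionals
  that agree on \<open>V\<close>, and vectors at distance 0.\<close>

definition topological_dual ::
    "('b \<Rightarrow> complex) set \<Rightarrow> (('b \<Rightarrow> complex) \<Rightarrow> real) \<Rightarrow> (('b \<Rightarrow> complex) \<Rightarrow> complex) set" where
  "topological_dual V N = {\<phi>.
     (\<forall>f\<in>V. \<forall>g\<in>V. \<phi> (\<lambda>t. f t + g t) = \<phi> f + \<phi> g) \<and>
     (\<forall>c. \<forall>f\<in>V. \<phi> (\<lambda>t. c * f t) = c * \<phi> f) \<and>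
     (\<exists>C. \<forall>f\<in>V. cmod (\<phi> f) \<le> C * N f)}"

definition dual_norm ::
    "('b \<Rightarrow> complex) set \<Rightarrow> (('b \<Rightarrow> complex) \<Rightarrow> real) \<Rightarrow> (('b \<Rightarrow> complex) \<Rightarrow> complex) \<Rightarrow> real" where
  "dual_norm V N \<phi> = (SUP f\<in>{f\<in>V. N f \<le> 1}. cmod (\<phi> f))"

definition reflexive_space :: "('b \<Rightarrow> complex) set \<Rightarrow> (('b \<Rightarrow> complex) \<Rightarrow> real) \<Rightarrow> bool" where
  "reflexive_space V N \<longleftrightarrow>
     (\<forall>\<Phi> \<in> topological_dual (topological_dual V N) (dual_norm V N).
        \<exists>f\<in>V. \<forall>\<phi>\<in>topological_dual V N. \<Phi> \<phi> = \<phi> f)"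

definition p_convex :: "real \<Rightarrow> ('a \<Rightarrow> complex) set \<Rightarrow> (('a \<Rightarrow> complex) \<Rightarrow> real) \<Rightarrow> bool" where
  "p_convex p X N \<longleftrightarrow> (\<exists>C. \<forall>(n::nat) x. (\<forall>i<n. x i \<in> X) \<longrightarrow>
     N (\<lambda>t. complex_of_real ((\<Sum>i<n. cmod (x i t) powr p) powr (1 / p)))
       \<le> C * (\<Sum>i<n. N (x i) powr p) powr (1 / p))"

definition disjointly_supported :: "'a measure \<Rightarrow> 'i set \<Rightarrow> ('i \<Rightarrow> 'a \<Rightarrow> complex) \<Rightarrow> bool" where
  "disjointly_supported M I x \<longleftrightarrow>
     (\<forall>i\<in>I. \<forall>j\<in>I. i \<noteq> j \<longrightarrow> (AE t in M. x i t = 0 \<or> x j t = 0))"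

definition closed_linear_span ::
    "('a \<Rightarrow> complex) set \<Rightarrow> (('a \<Rightarrow> complex) \<Rightarrow> real) \<Rightarrow> (nat \<Rightarrow> 'a \<Rightarrow> complex) \<Rightarrow> ('a \<Rightarrow> complex) set" where
  "closed_linear_span X N u =
     {f\<in>X. \<forall>e>0. \<exists>n c. N (\<lambda>t. f t - (\<Sum>k<n. c k * u k t)) < e}"

definition disjointly_generated ::
    "'a measure \<Rightarrow> ('a \<Rightarrow> complex) set \<Rightarrow> (('a \<Rightarrow> complex) \<Rightarrow> real) \<Rightarrow> ('a \<Rightarrow> complex) set \<Rightarrow> bool" where
  "disjointly_generated M X N Y \<longleftrightarrow>
     (\<exists>u::nat \<Rightarrow> 'a \<Rightarrow> complex.
        (\<forall>k. u k \<in> X \<and> \<not> (AE t in M. u k t = 0)) \<and>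
        disjointly_supported M UNIV u \<and>
        Y = closed_linear_span X N u)"

text \<open>The supremum is taken over a nonempty set bounded by \<open>n\<close>, see
  \<open>bdd_above_disjoint_sums\<close> below, so the real supremum is the intended one.\<close>

definition M_param ::
    "'a measure \<Rightarrow> (('a \<Rightarrow> complex) \<Rightarrow> real) \<Rightarrow> ('a \<Rightarrow> complex) set \<Rightarrow> nat \<Rightarrow> real" where
  "M_param M N Y n = Sup {N (\<lambda>t. \<Sum>i<n. x i t) | x.
     (\<forall>i<n. x i \<in> Y \<and> N (x i) \<le> 1) \<and> disjointly_supported M {..<n} x}"

definition asymp_equiv_bounds :: "(nat \<Rightarrow> real) \<Rightarrow> (nat \<Rightarrow> real) \<Rightarrow> bool" where
  "asymp_equiv_bounds f g \<longleftrightarrow>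
     0 < liminf (\<lambda>n. ereal (f n / g n)) \<and> limsup (\<lambda>n. ereal (f n / g n)) < \<infinity>"

definition kalton_peck ::
    "(('a \<Rightarrow> complex) \<Rightarrow> real) \<Rightarrow> ('a \<Rightarrow> complex) \<Rightarrow> 'a \<Rightarrow> complex" where
  "kalton_peck N x = (\<lambda>t. if N x = 0 \<or> x t = 0 then 0
                          else x t * complex_of_real (ln (cmod (x t) / N x)))"

definition linear_into_L0 ::
    "'a measure \<Rightarrow> ('a \<Rightarrow> complex) set \<Rightarrow> (('a \<Rightarrow> complex) \<Rightarrow> 'a \<Rightarrow> complex) \<Rightarrow> bool" where
  "linear_into_L0 M W l \<longleftrightarrow>
     (\<forall>x\<in>W. l x \<in> borel_measurable M) \<and>
     (\<forall>x\<in>W. \<forall>y\<in>W. (AE t in M. x t = y t) \<longrightarrow> (AE t in M. l x t = l y t)) \<and>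
     (\<forall>x\<in>W. \<forall>y\<in>W. AE t in M. l (\<lambda>s. x s + y s) t = l x t + l y t) \<and>
     (\<forall>c. \<forall>x\<in>W. AE t in M. l (\<lambda>s. c * x s) t = c * l x t)"

definition trivial_on ::
    "'a measure \<Rightarrow> ('a \<Rightarrow> complex) set \<Rightarrow> (('a \<Rightarrow> complex) \<Rightarrow> real) \<Rightarrow>
     (('a \<Rightarrow> complex) \<Rightarrow> 'a \<Rightarrow> complex) \<Rightarrow> ('a \<Rightarrow> complex) set \<Rightarrow> bool" where
  "trivial_on M X N \<Omega> W \<longleftrightarrow>
     (\<exists>l C. linear_into_L0 M W l \<and>
        (\<forall>x\<in>W. (\<lambda>t. \<Omega> x t - l x t) \<in> X \<and> N (\<lambda>t. \<Omega> x t - l x t) \<le> C * N x))"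

definition disjointly_singular ::
    "'a measure \<Rightarrow> ('a \<Rightarrow> complex) set \<Rightarrow> (('a \<Rightarrow> complex) \<Rightarrow> real) \<Rightarrow>
     (('a \<Rightarrow> complex) \<Rightarrow> 'a \<Rightarrow> complex) \<Rightarrow> bool" where
  "disjointly_singular M X N \<Omega> \<longleftrightarrow>
     (\<forall>W. disjointly_generated M X N W \<longrightarrow> \<not> trivial_on M X N \<Omega> W)"

context koethe_function_space
begin

lemma norm_nonneg:
  assumes "f \<in> X" shows "0 \<le> N f"
proof -
  have "(\<lambda>t. (-1) * f t) \<in> X" "N (\<lambda>t. (-1) * f t) = N f"
    using scale_closed[OF assms, of "-1"] norm_scale[OF assms, of "-1"] by simp_all
  moreover have "N (\<lambda>_. 0) = 0" using norm_eq_0_iff[OF zero_closed] by simp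
  ultimately show ?thesis using norm_triangle[OF assms, of "\<lambda>t. (-1) * f t"] by simp
qed

lemma norm_cong_AE:
  assumes "f \<in> X" "g \<in> X" "AE t in M. f t = g t" shows "N f = N g"
proof (rule antisym)
  have m: "f \<in> borel_measurable M" "g \<in> borel_measurable M"
    using assms measurable_carrier by auto
  show "N f \<le> N g" using ideal[OF assms(2) m(1)] eventually_mono[OF assms(3), of "\<lambda>t. cmod (f t) \<le> cmod (g t)"] by simp
  show "N g \<le> N f" using ideal[OF assms(1) m(2)] eventually_mono[OF assms(3), of "\<lambda>t. cmod (g t) \<le> cmod (f t)"] by simp
qed

lemma sum_closed_norm_le:
  fixes n :: nat and x :: "nat \<Rightarrow> 'a \<Rightarrow> complex"
  assumes "\<And>i. i < n \<Longrightarrow> x i \<in> X \<and> N (x i) \<le> 1"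
  shows "(\<lambda>t. \<Sum>i<n. x i t) \<in> X \<and> N (\<lambda>t. \<Sum>i<n. x i t) \<le> real n"
  using assms
proof (induction n)
  case 0
  then show ?case using zero_closed norm_eq_0_iff[OF zero_closed] by simp
next
  case (Suc n)
  have "(\<lambda>t. \<Sum>i<n. x i t) \<in> X \<and> N (\<lambda>t. \<Sum>i<n. x i t) \<le> real n" "x n \<in> X \<and> N (x n) \<le> 1"
    using Suc by auto
  then show ?case
    using add_closed[of "\<lambda>t. \<Sum>i<n. x i t" "x n"] norm_triangle[of "\<lambda>t. \<Sum>i<n. x i t" "x n"]
    by auto
qed

lemma bdd_above_disjoint_sums:
  fixes n :: nat
  assumes "Y \<subseteq> X"
  shows "bdd_above {N (\<lambda>t. \<Sum>i<n. x i t) | x.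
     (\<forall>i<n. x i \<in> Y \<and> N (x i) \<le> 1) \<and> disjointly_supported M {..<n} x}"
proof (rule bdd_aboveI[of _ "real n"], clarify)
  fix x assume "\<forall>i<n. x i \<in> Y \<and> N (x i) \<le> 1"
  then show "N (\<lambda>t. \<Sum>i<n. x i t) \<le> real n"
    using sum_closed_norm_le[of n x] assms by blast
qed

text \<open>The Kalton--Peck map is a well-defined homogeneous map on classes.\<close>

lemma kalton_peck_measurable:
  assumes "x \<in> X" shows "kalton_peck N x \<in> borel_measurable M"
proof -
  have [measurable]: "x \<in> borel_measurable M" using assms measurable_carrier by auto
  show ?thesis unfolding kalton_peck_def by measurable
qed

lemma kalton_peck_cong_AE:
  assumes "x \<in> X" "y \<in> X" "AE t in M. x t = y t"
  shows "AE t in M. kalton_peck N x t = kalton_peck N y t"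
  using assms(3) norm_cong_AE[OF assms] by (auto simp: kalton_peck_def)

lemma kalton_peck_homogeneous:
  assumes "x \<in> X" shows "kalton_peck N (\<lambda>t. c * x t) = (\<lambda>t. c * kalton_peck N x t)"
  by (auto simp: kalton_peck_def norm_scale[OF assms] norm_mult fun_eq_iff)

end

end

theory Submission
  imports Defs
begin

text \<open>Suppose \<open>\<K> - l\<close> is bounded on \<open>W\<close>, the closed span of a disjoint sequence, with \<open>l\<close> linear.
  Averaging over unimodular coefficients makes \<open>l\<close> preserve the supports of given disjoint vectors
  \<open>x\<^sub>1, \<dots>, x\<^sub>n\<close> in the unit ball of \<open>W\<close>; comparing the defects of the \<open>x\<^sub>k\<close> with that of their sum
  \<open>s\<close> gives \<open>\<parallel>s\<parallel> ln \<parallel>s\<parallel> \<le> C \<parallel>s\<parallel> + C M\<^sub>X(n)\<close> once \<open>\<parallel>s\<parallel> \<ge> 1\<close>.  Choosing \<open>\<parallel>s\<parallel>\<close> close to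
  \<open>M\<^sub>W(n)\<close>, which is comparable to \<open>M\<^sub>X(n)\<close>, shows that \<open>M\<^sub>X\<close> is bounded.  Then every normalized
  disjoint sequence is equivalent to the unit vector basis of \<open>c\<^sub>0\<close>, which is impossible in a
  reflexive space.\<close>

section \<open>The Hahn--Banach theorem for seminorms\<close>

text \<open>Homogeneity is asked for nonnegative real factors only, because \<open>V\<close> is
  first treated as a real vector space; values may be negative.\<close>

definition sublinear_on :: "('b \<Rightarrow> complex) set \<Rightarrow> (('b \<Rightarrow> complex) \<Rightarrow> real) \<Rightarrow> bool" where
  "sublinear_on V p \<longleftrightarrow>
     (\<forall>f\<in>V. \<forall>g\<in>V. p (\<lambda>t. f t + g t) \<le> p f + p g) \<and>
     (\<forall>c\<ge>0. \<forall>f\<in>V. p (\<lambda>t. complex_of_real c * f t) = c * p f)"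

locale complex_function_space =
  fixes V :: "('b \<Rightarrow> complex) set"
  assumes zero_mem: "(\<lambda>_. 0) \<in> V"
    and add_mem: "f \<in> V \<Longrightarrow> g \<in> V \<Longrightarrow> (\<lambda>t. f t + g t) \<in> V"
    and scale_mem: "f \<in> V \<Longrightarrow> (\<lambda>t. c * f t) \<in> V"
begin

lemma uminus_mem: "f \<in> V \<Longrightarrow> (\<lambda>t. - f t) \<in> V"
  using scale_mem[of f "-1"] by simp

lemma sum_mem:
  fixes n :: nat
  assumes "\<And>i. i < n \<Longrightarrow> x i \<in> V"
  shows "(\<lambda>t. \<Sum>i<n. x i t) \<in> V"
  using assms by (induction n) (auto simp: zero_mem intro!: add_mem)

lemma sublinear_add:
  "sublinear_on V p \<Longrightarrow> f \<in> V \<Longrightarrow> g \<in> V \<Longrightarrow> p (\<lambda>t. f t + g t) \<le> p f + p g"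
  by (simp add: sublinear_on_def)

lemma sublinear_scale:
  "sublinear_on V p \<Longrightarrow> f \<in> V \<Longrightarrow> 0 \<le> c \<Longrightarrow> p (\<lambda>t. complex_of_real c * f t) = c * p f"
  by (simp add: sublinear_on_def)

lemma sublinear_zero: "sublinear_on V p \<Longrightarrow> p (\<lambda>_. 0) = 0"
  using sublinear_scale[of p "\<lambda>_. 0" 0] zero_mem by simp

lemma sublinear_ge_uminus:
  assumes "sublinear_on V p" "f \<in> V"
  shows "- p (\<lambda>t. - f t) \<le> p f"
  using sublinear_add[OF assms uminus_mem[OF assms(2)]] sublinear_zero[OF assms(1)] by simp

text \<open>One inequality suffices for homogeneity: applied to the factor \<open>1 / c\<close> it
  yields the reverse one.\<close>

lemma sublinear_onI:
  assumes add: "\<And>f g. f \<in> V \<Longrightarrow> g \<in> V \<Longrightarrow> p (\<lambda>t. f t + g t) \<le> p f + p g"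
    and zero: "p (\<lambda>_. 0) = 0"
    and scale: "\<And>c f. c > 0 \<Longrightarrow> f \<in> V \<Longrightarrow> c * p f \<le> p (\<lambda>t. complex_of_real c * f t)"
  shows "sublinear_on V p"
proof -
  have "p (\<lambda>t. complex_of_real c * f t) = c * p f" if "c \<ge> 0" "f \<in> V" for c f
  proof (cases "c = 0")
    case True
    then show ?thesis using zero by simp
  next
    case False
    then have c: "c > 0" using that by simp
    have "(1/c) * p (\<lambda>t. complex_of_real c * f t) \<le> p f"
      using scale[of "1/c" "\<lambda>t. complex_of_real c * f t"] c scale_mem[OF that(2)] by simp
    then show ?thesis using scale[OF c that(2)] c by (simp add: field_simps)
  qed
  then show ?thesis using add by (simp add: sublinear_on_def)
qed

text \<open>Take the infimum over \<open>s \<ge> 0\<close> of \<open>p (f + s h) - s p h\<close>. At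
  \<open>s = 0\<close> it gives \<open>r \<le> p\<close>, and at \<open>-h\<close> with
  \<open>s = 1\<close> it gives \<open>r (-h) \<le> - p h\<close>.\<close>

lemma sublinear_reduce:
  assumes p: "sublinear_on V p" and h: "h \<in> V"
  shows "\<exists>r. sublinear_on V r \<and> (\<forall>f\<in>V. r f \<le> p f) \<and> r (\<lambda>t. - h t) \<le> - p h"
proof -
  define F where "F f s = p (\<lambda>t. f t + complex_of_real s * h t) - s * p h" for f s
  define r where "r f = (INF s\<in>{0..}. F f s)" for f
  have mem: "(\<lambda>t. f t + complex_of_real s * h t) \<in> V" if "f \<in> V" for f s
    using add_mem[OF that scale_mem[OF h]] .
  \<comment> \<open>Since \<open>s p h = p (s h)\<close>, subadditivity bounds the family below
    independently of \<open>s\<close>, so the infimum is a genuine real.\<close>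
  have lb: "- p (\<lambda>t. - f t) \<le> F f s" if "f \<in> V" "s \<ge> 0" for f s
    using sublinear_add[OF p mem[OF that(1), of s] uminus_mem[OF that(1)]]
      sublinear_scale[OF p h that(2)] by (simp add: F_def)
  have r_le: "r f \<le> F f s" if "f \<in> V" "s \<ge> 0" for f s
    unfolding r_def using that lb[OF that(1)] by (intro cINF_lower bdd_belowI2) auto
  have r_ge: "a \<le> r f" if "\<And>s. s \<ge> 0 \<Longrightarrow> a \<le> F f s" for f a
    unfolding r_def using that by (intro cINF_greatest) auto
  have "sublinear_on V r"
  proof (rule sublinear_onI)
    fix f g assume fg: "f \<in> V" "g \<in> V"
    have "r (\<lambda>t. f t + g t) \<le> F f a + F g b" if "a \<ge> 0" "b \<ge> 0" for a b
    proof -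
      have "r (\<lambda>t. f t + g t) \<le> F (\<lambda>t. f t + g t) (a + b)"
        using that by (intro r_le add_mem fg) auto
      also have "\<dots> \<le> F f a + F g b"
        using sublinear_add[OF p mem[OF fg(1), of a] mem[OF fg(2), of b]]
        by (simp add: F_def algebra_simps)
      finally show ?thesis .
    qed
    then have "r (\<lambda>t. f t + g t) - F g b \<le> r f" if "b \<ge> 0" for b
      using that by (intro r_ge) (auto simp: algebra_simps)
    then have "r (\<lambda>t. f t + g t) - r f \<le> r g"
      by (intro r_ge) (auto simp: algebra_simps)
    then show "r (\<lambda>t. f t + g t) \<le> r f + r g" by simp
  next
    have "F (\<lambda>_. 0) s = 0" if "s \<ge> 0" for s
      using sublinear_scale[OF p h that] by (simp add: F_def)
    then show "r (\<lambda>_. 0) = 0" by (simp add: r_def)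
  next
    fix c :: real and f assume c: "c > 0" and f: "f \<in> V"
    show "c * r f \<le> r (\<lambda>t. complex_of_real c * f t)"
    proof (rule r_ge)
      fix s :: real assume s: "s \<ge> 0"
      have "c * r f \<le> c * F f (s / c)" using c s by (intro mult_left_mono r_le f) auto
      also have "\<dots> = F (\<lambda>t. complex_of_real c * f t) s"
        using sublinear_scale[OF p mem[OF f, of "s/c"], of c] c
        by (simp add: F_def algebra_simps)
      finally show "c * r f \<le> F (\<lambda>t. complex_of_real c * f t) s" .
    qed
  qed
  moreover have "r f \<le> p f" if "f \<in> V" for f
    using r_le[OF that, of 0] by (simp add: F_def)
  moreover have "r (\<lambda>t. - h t) \<le> - p h"
    using r_le[OF uminus_mem[OF h], of 1] sublinear_zero[OF p] by (simp add: F_def)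
  ultimately show ?thesis by blast
qed

text \<open>Zorn's lemma applies since the pointwise infimum of a nonempty chain is again sublinear;
  it is finite because every member lies above \<open>- q (- f)\<close>.\<close>

lemma sublinear_minimal:
  assumes q: "sublinear_on V q"
  shows "\<exists>p. sublinear_on V p \<and> (\<forall>f\<in>V. p f \<le> q f) \<and>
           (\<forall>r. sublinear_on V r \<longrightarrow> (\<forall>f\<in>V. r f \<le> p f) \<longrightarrow> (\<forall>f\<in>V. r f = p f))"
proof -
  \<comment> \<open>Values off \<open>V\<close> are fixed to 0; otherwise they could be lowered
    forever and no minimal element would exist.\<close>
  define A where "A = {p. sublinear_on V p \<and> (\<forall>f\<in>V. p f \<le> q f) \<and> (\<forall>f. f \<notin> V \<longrightarrow> p f = 0)}"
  \<comment> \<open>The order is reversed, so a maximal element in Zorn's lemma is a minimal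
    functional.\<close>
  define P where "P a b \<longleftrightarrow> (\<forall>f. b f \<le> a f)" for a b :: "('b \<Rightarrow> complex) \<Rightarrow> real"
  have "\<exists>m\<in>A. \<forall>a\<in>A. P m a \<longrightarrow> a = m"
  proof (rule predicate_Zorn)
    show "partial_order_on A (relation_of P A)"
      unfolding P_def by (rule partial_order_on_relation_ofI) (auto intro: order_trans simp: fun_eq_iff antisym)
  next
    fix C assume "C \<in> Chains (relation_of P A)"
    then have CA: "C \<subseteq> A" and chain: "\<And>a b. a \<in> C \<Longrightarrow> b \<in> C \<Longrightarrow> P a b \<or> P b a"
      by (auto simp: Chains_def relation_of_def)
    show "\<exists>u\<in>A. \<forall>a\<in>C. P a u"
    proof (cases "C = {}")
      case True
      have "(\<lambda>f. if f \<in> V then q f else 0) \<in> A"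
        using q by (auto simp: A_def sublinear_on_def add_mem scale_mem)
      then show ?thesis using True by blast
    next
      case False
      define u where "u f = (if f \<in> V then INF p\<in>C. p f else 0)" for f
      have C: "sublinear_on V p" "f \<in> V \<Longrightarrow> p f \<le> q f" "f \<notin> V \<Longrightarrow> p f = 0" if "p \<in> C" for p f
        using that CA by (auto simp: A_def)
      have lb: "- q (\<lambda>t. - f t) \<le> p f" if "f \<in> V" "p \<in> C" for f p
        using sublinear_ge_uminus[OF C(1)[OF that(2)] that(1)] C(2)[OF that(2) uminus_mem[OF that(1)]]
        by linarith
      have u_le: "u f \<le> p f" if "f \<in> V" "p \<in> C" for f p
        using that lb[OF that(1)] unfolding u_def by (auto intro!: cINF_lower bdd_belowI2)
      have u_ge: "a \<le> u f" if "f \<in> V" "\<And>p. p \<in> C \<Longrightarrow> a \<le> p f" for f a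
        using that False unfolding u_def by (auto intro!: cINF_greatest)
      have "sublinear_on V u"
      proof (rule sublinear_onI)
        fix f g assume fg: "f \<in> V" "g \<in> V"
        have "u (\<lambda>t. f t + g t) \<le> a f + b g" if ab: "a \<in> C" "b \<in> C" for a b
        proof -
          \<comment> \<open>In a chain, the smaller of \<open>a\<close> and \<open>b\<close> lies
            below both of them.\<close>
          obtain c where c: "c \<in> C" "c f \<le> a f" "c g \<le> b g"
            using chain[OF ab] ab unfolding P_def by blast
          show ?thesis
            using u_le[OF add_mem[OF fg] c(1)] sublinear_add[OF C(1)[OF c(1)] fg] c by linarith
        qed
        then have "u (\<lambda>t. f t + g t) - b g \<le> u f" if "b \<in> C" for b
          using that fg by (intro u_ge) (auto simp: algebra_simps)
        then have "u (\<lambda>t. f t + g t) - u f \<le> u g"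
          using fg by (intro u_ge) (auto simp: algebra_simps)
        then show "u (\<lambda>t. f t + g t) \<le> u f + u g" by simp
      next
        show "u (\<lambda>_. 0) = 0"
          using False u_le[OF zero_mem] u_ge[OF zero_mem, of 0] sublinear_zero[OF C(1)]
          by (metis all_not_in_conv antisym order_refl)
      next
        fix c :: real and f assume c: "c > 0" and f: "f \<in> V"
        show "c * u f \<le> u (\<lambda>t. complex_of_real c * f t)"
        proof (rule u_ge[OF scale_mem[OF f]])
          fix p assume p: "p \<in> C"
          show "c * u f \<le> p (\<lambda>t. complex_of_real c * f t)"
            using sublinear_scale[OF C(1)[OF p] f, of c] u_le[OF f p] c by simp
        qed
      qed
      moreover have "u f \<le> q f" if "f \<in> V" for f
        using False u_le[OF that] C(2) that by (meson all_not_in_conv order_trans)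
      ultimately have "u \<in> A" by (simp add: A_def u_def)
      moreover have "P a u" if "a \<in> C" for a
        unfolding P_def using u_le[OF _ that] C(3)[OF that] by (metis order_refl u_def)
      ultimately show ?thesis by blast
    qed
  qed
  then obtain m where m: "m \<in> A" and min: "\<And>a. a \<in> A \<Longrightarrow> P m a \<Longrightarrow> a = m" by blast
  have "\<forall>f\<in>V. r f = m f" if r: "sublinear_on V r" "\<forall>f\<in>V. r f \<le> m f" for r
  proof -
    let ?r = "\<lambda>f. if f \<in> V then r f else 0"
    have "sublinear_on V ?r" using r(1) by (auto simp: sublinear_on_def add_mem scale_mem)
    then have "?r \<in> A" using m r(2) by (auto simp: A_def intro: order_trans)
    moreover have "P m ?r" using m r(2) by (auto simp: A_def P_def)
    ultimately have "?r = m" by (rule min)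
    then show ?thesis by (auto simp: fun_eq_iff split: if_splits)
  qed
  then show ?thesis using m by (auto simp: A_def)
qed

text \<open>A minimal sublinear functional is odd by \<open>sublinear_reduce\<close>, and an odd sublinear
  functional is real-linear.\<close>

lemma real_hahn_banach:
  assumes q: "sublinear_on V q" and h: "h \<in> V"
  shows "\<exists>g. (\<forall>x\<in>V. \<forall>y\<in>V. g (\<lambda>t. x t + y t) = g x + g y) \<and>
             (\<forall>c. \<forall>x\<in>V. g (\<lambda>t. complex_of_real c * x t) = c * g x) \<and>
             (\<forall>x\<in>V. g x \<le> q x) \<and> g h = (q h :: real)"
proof -
  \<comment> \<open>Reducing at \<open>h\<close> first forces any odd functional below
    \<open>r\<close> to be at least \<open>q h\<close> at \<open>h\<close>.\<close>
  obtain r where r: "sublinear_on V r" "\<And>f. f \<in> V \<Longrightarrow> r f \<le> q f" "r (\<lambda>t. - h t) \<le> - q h"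
    using sublinear_reduce[OF q h] by blast
  obtain g where g: "sublinear_on V g" "\<And>f. f \<in> V \<Longrightarrow> g f \<le> r f"
    and min: "\<forall>s. sublinear_on V s \<longrightarrow> (\<forall>f\<in>V. s f \<le> g f) \<longrightarrow> (\<forall>f\<in>V. s f = g f)"
    using sublinear_minimal[OF r(1)] by blast
  have odd: "g (\<lambda>t. - f t) = - g f" if f: "f \<in> V" for f
  proof -
    \<comment> \<open>By minimality the reduction of \<open>g\<close> at \<open>f\<close> coincides
      with \<open>g\<close>.\<close>
    obtain s where s: "sublinear_on V s" "\<And>k. k \<in> V \<Longrightarrow> s k \<le> g k" "s (\<lambda>t. - f t) \<le> - g f"
      using sublinear_reduce[OF g(1) f] by blast
    have "g (\<lambda>t. - f t) \<le> - g f" using min s uminus_mem[OF f] by metis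
    then show ?thesis using sublinear_ge_uminus[OF g(1) f] by simp
  qed
  have add: "g (\<lambda>t. x t + y t) = g x + g y" if xy: "x \<in> V" "y \<in> V" for x y
    using sublinear_add[OF g(1) add_mem[OF xy] uminus_mem[OF xy(2)]] odd[OF xy(2)]
      sublinear_add[OF g(1) xy] by simp
  have scale: "g (\<lambda>t. complex_of_real c * x t) = c * g x" if x: "x \<in> V" for c x
  proof (cases "c \<ge> 0")
    case True
    then show ?thesis using sublinear_scale[OF g(1) x] by simp
  next
    case False
    then show ?thesis
      using sublinear_scale[OF g(1) x, of "- c"] odd[OF scale_mem[OF x, of "complex_of_real (-c)"]] by simp
  qed
  have le: "g x \<le> q x" if "x \<in> V" for x using g(2)[OF that] r(2)[OF that] by simp
  have "g h \<ge> q h" using g(2)[OF uminus_mem[OF h]] r(3) odd[OF h] by simp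
  then have "g h = q h" using le[OF h] by simp
  then show ?thesis using add scale le by blast
qed

lemma hahn_banach_seminorm:
  assumes add: "\<And>x y. x \<in> V \<Longrightarrow> y \<in> V \<Longrightarrow> q (\<lambda>t. x t + y t) \<le> q x + q y"
    and scale: "\<And>c x. x \<in> V \<Longrightarrow> q (\<lambda>t. c * x t) = cmod c * q x"
    and h: "h \<in> V"
  shows "\<exists>\<phi>. (\<forall>x\<in>V. \<forall>y\<in>V. \<phi> (\<lambda>t. x t + y t) = \<phi> x + \<phi> y) \<and>
             (\<forall>c. \<forall>x\<in>V. \<phi> (\<lambda>t. c * x t) = c * \<phi> x) \<and>
             (\<forall>x\<in>V. cmod (\<phi> x) \<le> q x) \<and> Re (\<phi> h) = q h"
proof -
  have "sublinear_on V q" using add scale by (simp add: sublinear_on_def)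
  then obtain g where g_add: "\<And>x y. x \<in> V \<Longrightarrow> y \<in> V \<Longrightarrow> g (\<lambda>t. x t + y t) = g x + g y"
    and g_scale: "\<And>c x. x \<in> V \<Longrightarrow> g (\<lambda>t. complex_of_real c * x t) = c * g x"
    and g_le: "\<And>x. x \<in> V \<Longrightarrow> g x \<le> q x" and g_h: "g h = q h"
    using real_hahn_banach[OF _ h] by blast
  define \<phi> where "\<phi> x = Complex (g x) (- g (\<lambda>t. \<i> * x t))" for x
  have "\<phi> (\<lambda>t. x t + y t) = \<phi> x + \<phi> y" if "x \<in> V" "y \<in> V" for x y
    using g_add[OF that] g_add[OF scale_mem[OF that(1), of \<i>] scale_mem[OF that(2), of \<i>]]
    by (simp add: \<phi>_def complex_eq_iff distrib_left)
  moreover have \<phi>_scale: "\<phi> (\<lambda>t. c * x t) = c * \<phi> x" if x: "x \<in> V" for c x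
  proof -
    have eq: "g (\<lambda>t. c * x t) = Re c * g x + Im c * g (\<lambda>t. \<i> * x t)" for c
    proof -
      have "(\<lambda>t. c * x t) = (\<lambda>t. complex_of_real (Re c) * x t + complex_of_real (Im c) * (\<i> * x t))"
        by (auto simp: fun_eq_iff complex_eq_iff)
      then show ?thesis
        using g_add[OF scale_mem[OF x, of "complex_of_real (Re c)"]
            scale_mem[OF scale_mem[OF x, of \<i>], of "complex_of_real (Im c)"]]
          g_scale[OF x, of "Re c"] g_scale[OF scale_mem[OF x, of \<i>], of "Im c"] by simp
    qed
    show ?thesis
      using eq[of c] eq[of "\<i> * c"] by (simp add: \<phi>_def complex_eq_iff mult.assoc)
  qed
  moreover have "cmod (\<phi> x) \<le> q x" if x: "x \<in> V" for x
  proof (cases "\<phi> x = 0")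
    case True
    have "0 \<le> q x" using add[OF x scale_mem[OF x, of "-1"]] scale[OF x, of "-1"] scale[OF x, of 0] by simp
    then show ?thesis using True by simp
  next
    case False
    \<comment> \<open>This rotation of \<open>x\<close> makes the value of \<phi> real and equal to
      its modulus, where the bound on \<open>g\<close> applies.\<close>
    define c where "c = complex_of_real (cmod (\<phi> x)) / \<phi> x"
    have c: "cmod c = 1" "c * \<phi> x = complex_of_real (cmod (\<phi> x))"
      using False by (auto simp: c_def norm_divide)
    have "cmod (\<phi> x) = Re (\<phi> (\<lambda>t. c * x t))" using \<phi>_scale[OF x, of c] c by simp
    also have "\<dots> \<le> q (\<lambda>t. c * x t)" using g_le[OF scale_mem[OF x]] by (simp add: \<phi>_def)
    also have "\<dots> = q x" using scale[OF x] c by simp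
    finally show ?thesis .
  qed
  moreover have "Re (\<phi> h) = q h" by (simp add: \<phi>_def g_h)
  ultimately show ?thesis by blast
qed

end

section \<open>The defect of the Kalton--Peck map on disjoint sums\<close>

lemma sum_eq_single:
  fixes g :: "nat \<Rightarrow> 'b::comm_monoid_add"
  assumes "i < n" "\<And>k. k < n \<Longrightarrow> k \<noteq> i \<Longrightarrow> g k = 0"
  shows "(\<Sum>k<n. g k) = g i"
proof -
  have "(\<Sum>k<n. g k) = (\<Sum>k\<in>{i}. g k)"
    using assms by (intro sum.mono_neutral_right) auto
  then show ?thesis by simp
qed

text \<open>Discrete Fourier inversion: \<open>w j i\<close> is the \<open>j\<close>-th power of the
  \<open>i\<close>-th root of unity of order \<open>n\<close>, and the geometric sums vanish off the
  diagonal. It recovers one term of a sum from \<open>n\<close> unimodular recombinations.\<close>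

lemma unimodular_orthogonality:
  assumes "n > 0"
  shows "\<exists>w :: nat \<Rightarrow> nat \<Rightarrow> complex. (\<forall>j i. cmod (w j i) = 1) \<and>
    (\<forall>i<n. \<forall>a. (\<Sum>j<n. cnj (w j i) * (\<Sum>k<n. w j k * a k)) = of_nat n * a i)"
proof -
  define z where "z k = exp (2 * of_real pi * \<i> * of_nat k / of_nat n)" for k :: nat
  have norm_z: "cmod (z k) = 1" for k by (simp add: z_def)
  have z_pow: "z k ^ n = 1" for k using complex_root_unity[of n k] assms by (simp add: z_def)
  have ortho: "(\<Sum>j<n. (cnj (z i) * z k) ^ j) = (if k = i then of_nat n else 0)"
    if "i < n" "k < n" for i k
  proof (cases "k = i")
    case True
    have "cnj (z i) * z i = 1" using norm_z[of i] by (simp add: mult.commute complex_norm_square[symmetric])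
    then show ?thesis using True by simp
  next
    case False
    have "cnj (z i) * z k \<noteq> 1"
    proof
      assume "cnj (z i) * z k = 1"
      moreover have "z i * cnj (z i) = 1" using norm_z[of i] by (simp add: complex_norm_square[symmetric])
      ultimately have "z k = z i" by (metis mult.assoc mult.right_neutral mult_1)
      then have "k mod n = i mod n"
        using complex_root_unity_eq[of n k i] assms by (simp add: z_def)
      then show False using that False by simp
    qed
    moreover have "(cnj (z i) * z k) ^ n = 1"
      using z_pow by (simp add: power_mult_distrib flip: complex_cnj_power)
    ultimately show ?thesis using False by (simp add: sum_gp_strict)
  qed
  have "(\<Sum>j<n. cnj (z i ^ j) * (\<Sum>k<n. z k ^ j * a k)) = of_nat n * a i"
    if "i < n" for i a
  proof -
    have "(\<Sum>j<n. cnj (z i ^ j) * (\<Sum>k<n. z k ^ j * a k))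
        = (\<Sum>k<n. (\<Sum>j<n. (cnj (z i) * z k) ^ j) * a k)"
      by (simp add: sum_distrib_left sum_distrib_right power_mult_distrib mult.assoc)
         (rule sum.swap)
    also have "\<dots> = (\<Sum>j<n. (cnj (z i) * z i) ^ j) * a i"
      using ortho that by (intro sum_eq_single) auto
    finally show ?thesis using ortho that by simp
  qed
  moreover have "cmod (z i ^ j) = 1" for i j by (simp add: norm_power norm_z)
  ultimately show ?thesis by (intro exI[of _ "\<lambda>j k. z k ^ j"]) auto
qed

section \<open>Finite sums under linear maps into L_0, disjoint supports, asymptotic
  comparison\<close>

lemma linear_into_L0_add:
  assumes "linear_into_L0 M W l" "x \<in> W" "y \<in> W"
  shows "AE t in M. l (\<lambda>s. x s + y s) t = l x t + l y t"
  using assms by (simp add: linear_into_L0_def)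

lemma linear_into_L0_scale:
  assumes "linear_into_L0 M W l" "x \<in> W"
  shows "AE t in M. l (\<lambda>s. c * x s) t = c * l x t"
  using assms by (simp add: linear_into_L0_def)

lemma linear_into_L0_sum:
  fixes n :: nat
  assumes W: "complex_function_space W" and l: "linear_into_L0 M W l"
    and x: "\<And>i. i < n \<Longrightarrow> x i \<in> W"
  shows "AE t in M. l (\<lambda>t. \<Sum>k<n. c k * x k t) t = (\<Sum>k<n. c k * l (x k) t)"
  using x
proof (induction n)
  interpret complex_function_space W by fact
  case 0
  show ?case using linear_into_L0_scale[OF l zero_mem, of 0] by simp
next
  interpret complex_function_space W by fact
  case (Suc n)
  have mem: "(\<lambda>t. \<Sum>k<n. c k * x k t) \<in> W" "(\<lambda>t. c n * x n t) \<in> W" "x n \<in> W"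
    using Suc.prems by (auto intro!: sum_mem scale_mem)
  note linear_into_L0_add[OF l mem(1,2)] linear_into_L0_scale[OF l mem(3), of "c n"]
  moreover have "AE t in M. l (\<lambda>t. \<Sum>k<n. c k * x k t) t = (\<Sum>k<n. c k * l (x k) t)"
    using Suc by simp
  ultimately show ?case by eventually_elim simp
qed

text \<open>The null sets of the finitely many pairs are merged, so that later pointwise arguments
  have only these two cases.\<close>

lemma disjointly_supported_AE:
  fixes n :: nat
  assumes "disjointly_supported M {..<n} x"
  shows "AE t in M. (\<forall>i<n. x i t = 0) \<or> (\<exists>i<n. x i t \<noteq> 0 \<and> (\<forall>k<n. k \<noteq> i \<longrightarrow> x k t = 0))"
proof -
  have "AE t in M. \<forall>i\<in>{..<n}. \<forall>k\<in>{..<n}. i \<noteq> k \<longrightarrow> x i t = 0 \<or> x k t = 0"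
    using assms unfolding disjointly_supported_def
    by (intro AE_finite_allI finite_lessThan) (auto intro: eventually_mono)
  then show ?thesis
  proof eventually_elim
    case (elim t)
    show ?case
    proof (cases "\<exists>i<n. x i t \<noteq> 0")
      case True
      then obtain i where "i < n" "x i t \<noteq> 0" by blast
      moreover from this have "\<forall>k<n. k \<noteq> i \<longrightarrow> x k t = 0" using elim by auto
      ultimately show ?thesis by blast
    qed blast
  qed
qed

lemma asymp_equiv_bounds_imp_le:
  assumes "asymp_equiv_bounds f g" "\<forall>\<^sub>F n in sequentially. 0 < g n"
  shows "\<exists>R>0. \<forall>\<^sub>F n in sequentially. f n \<le> R * g n"
proof -
  have "limsup (\<lambda>n. ereal (f n / g n)) < \<infinity>" using assms(1) by (simp add: asymp_equiv_bounds_def)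
  then obtain r :: real where "limsup (\<lambda>n. ereal (f n / g n)) < ereal r"
    using ereal_dense2 by blast
  then have "\<forall>\<^sub>F n in sequentially. f n / g n < r"
    using Limsup_lessD by fastforce
  \<comment> \<open>\<open>r\<close> is not known to be positive; the maximum with 1 is.\<close>
  then have "\<forall>\<^sub>F n in sequentially. f n \<le> max r 1 * g n"
    using assms(2)
  proof eventually_elim
    case (elim n)
    then have "f n \<le> r * g n" by (simp add: field_simps)
    also have "\<dots> \<le> max r 1 * g n" using elim by (intro mult_right_mono) auto
    finally show ?case .
  qed
  then show ?thesis by (intro exI[of _ "max r 1"]) auto
qed

section \<open>Ideal property, closed spans and unimodular combinations in a Koethe function
  space\<close>

sublocale koethe_function_space \<subseteq> complex_function_space X
  by unfold_locales (fact zero_closed add_closed scale_closed)+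

context koethe_function_space
begin

lemma norm_zero: "N (\<lambda>_. 0) = 0"
  using norm_eq_0_iff[OF zero_closed] by simp

lemma measurable_mem: "f \<in> X \<Longrightarrow> f \<in> borel_measurable M"
  using measurable_carrier by blast

lemma norm_sum_le:
  fixes n :: nat
  assumes "\<And>i. i < n \<Longrightarrow> x i \<in> X"
  shows "N (\<lambda>t. \<Sum>i<n. x i t) \<le> (\<Sum>i<n. N (x i))"
  using assms
proof (induction n)
  case (Suc n)
  have "N (\<lambda>t. (\<Sum>i<n. x i t) + x n t) \<le> N (\<lambda>t. \<Sum>i<n. x i t) + N (x n)"
    using Suc.prems by (intro norm_triangle sum_mem) auto
  then show ?case using Suc by force
qed (simp add: norm_zero)

text \<open>The ideal property in the form used later: for indicators of supports, and for functions
  that undo unimodular coefficients.\<close>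

lemma multiplier:
  assumes "f \<in> X" "m \<in> borel_measurable M" "AE t in M. cmod (m t) \<le> 1"
  shows "(\<lambda>t. m t * f t) \<in> X" "N (\<lambda>t. m t * f t) \<le> N f"
proof -
  have "(\<lambda>t. m t * f t) \<in> borel_measurable M" using assms measurable_mem by measurable
  moreover have "AE t in M. cmod (m t * f t) \<le> cmod (f t)"
    using assms(3) by eventually_elim (simp add: norm_mult mult_left_le_one_le)
  ultimately show "(\<lambda>t. m t * f t) \<in> X" "N (\<lambda>t. m t * f t) \<le> N f"
    using ideal[OF assms(1)] by auto
qed

lemma M_param_ge:
  fixes n :: nat
  assumes "Y \<subseteq> X" "\<And>i. i < n \<Longrightarrow> x i \<in> Y" "\<And>i. i < n \<Longrightarrow> N (x i) \<le> 1"
    and "disjointly_supported M {..<n} x"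
  shows "N (\<lambda>t. \<Sum>i<n. x i t) \<le> M_param M N Y n"
  unfolding M_param_def using assms
  by (intro cSup_upper bdd_above_disjoint_sums) blast+

lemma complex_function_space_closed_linear_span:
  assumes u: "\<And>k. u k \<in> X"
  shows "complex_function_space (closed_linear_span X N u)"
proof
  show "(\<lambda>_. 0) \<in> closed_linear_span X N u"
    by (auto simp: closed_linear_span_def zero_mem norm_zero intro!: exI[of _ 0])
next
  fix f g assume f: "f \<in> closed_linear_span X N u" and g: "g \<in> closed_linear_span X N u"
  have mem: "f \<in> X" "g \<in> X" using f g by (auto simp: closed_linear_span_def)
  have "\<exists>n c. N (\<lambda>t. f t + g t - (\<Sum>k<n. c k * u k t)) < e" if "e > 0" for e :: real
  proof -
    obtain n c m d where n: "N (\<lambda>t. f t - (\<Sum>k<n. c k * u k t)) < e / 2"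
      and m: "N (\<lambda>t. g t - (\<Sum>k<m. d k * u k t)) < e / 2"
      using f g \<open>e > 0\<close> unfolding closed_linear_span_def by (auto dest!: spec[of _ "e/2"])
    \<comment> \<open>Padding with zero coefficients brings both combinations to a common
      length.\<close>
    let ?c = "\<lambda>k. (if k < n then c k else 0) + (if k < m then d k else 0)"
    have n_eq: "(\<Sum>k<max n m. (if k < n then c k else 0) * u k t) = (\<Sum>k<n. c k * u k t)"
      and m_eq: "(\<Sum>k<max n m. (if k < m then d k else 0) * u k t) = (\<Sum>k<m. d k * u k t)" for t
      by (rule sum.mono_neutral_cong_right; auto)+
    have sum_eq: "f t + g t - (\<Sum>k<max n m. ?c k * u k t)
        = (f t - (\<Sum>k<n. c k * u k t)) + (g t - (\<Sum>k<m. d k * u k t))" for t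
      unfolding distrib_right sum.distrib n_eq m_eq by simp
    have "N (\<lambda>t. f t + g t - (\<Sum>k<max n m. ?c k * u k t))
        = N (\<lambda>t. (f t - (\<Sum>k<n. c k * u k t)) + (g t - (\<Sum>k<m. d k * u k t)))"
      unfolding sum_eq ..
    also have "\<dots> \<le> N (\<lambda>t. f t - (\<Sum>k<n. c k * u k t)) + N (\<lambda>t. g t - (\<Sum>k<m. d k * u k t))"
      by (intro norm_triangle) (auto simp: diff_conv_add_uminus simp del: add_uminus_conv_diff
          intro!: mem u add_mem uminus_mem sum_mem scale_mem)
    finally show ?thesis using n m by (intro exI[of _ "max n m"] exI[of _ ?c]) simp
  qed
  then show "(\<lambda>t. f t + g t) \<in> closed_linear_span X N u"
    using mem by (auto simp: closed_linear_span_def add_mem)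
next
  fix f a assume f: "f \<in> closed_linear_span X N u"
  have mem: "f \<in> X" using f by (auto simp: closed_linear_span_def)
  have "\<exists>n c. N (\<lambda>t. a * f t - (\<Sum>k<n. c k * u k t)) < e" if "e > 0" for e :: real
  proof (cases "a = 0")
    case True
    then show ?thesis using that by (intro exI[of _ 0]) (simp add: norm_zero)
  next
    case False
    then have "e / cmod a > 0" using that by simp
    then obtain n c where n: "N (\<lambda>t. f t - (\<Sum>k<n. c k * u k t)) < e / cmod a"
      using f unfolding closed_linear_span_def by blast
    have "N (\<lambda>t. a * f t - (\<Sum>k<n. (a * c k) * u k t)) = N (\<lambda>t. a * (f t - (\<Sum>k<n. c k * u k t)))"
      by (simp add: right_diff_distrib sum_distrib_left mult.assoc)
    also have "\<dots> = cmod a * N (\<lambda>t. f t - (\<Sum>k<n. c k * u k t))"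
      by (intro norm_scale) (auto simp: diff_conv_add_uminus simp del: add_uminus_conv_diff
          intro!: mem u add_mem uminus_mem sum_mem scale_mem)
    also have "\<dots> < e" using n False by (simp add: field_simps)
    finally show ?thesis by (intro exI[of _ n] exI[of _ "\<lambda>k. a * c k"])
  qed
  then show "(\<lambda>t. a * f t) \<in> closed_linear_span X N u"
    using mem by (auto simp: closed_linear_span_def scale_mem)
qed

lemma generator_mem_closed_linear_span:
  assumes "\<And>k. u k \<in> X"
  shows "u j \<in> closed_linear_span X N u"
proof -
  have "(\<Sum>k<Suc j. (if k = j then 1 else 0) * u k t) = u j t" for t
    by (subst sum_eq_single[of j]) auto
  then have "N (\<lambda>t. u j t - (\<Sum>k<Suc j. (if k = j then 1 else 0) * u k t)) = 0"
    by (simp add: norm_zero)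
  then have "\<exists>n c. N (\<lambda>t. u j t - (\<Sum>k<n. c k * u k t)) < e" if "e > 0" for e
    using that by metis
  then show ?thesis using assms unfolding closed_linear_span_def by blast
qed

text \<open>At almost every point at most one summand is nonzero, so both sums have the same modulus
  there; the ideal property is applied in both directions.\<close>

lemma norm_unimodular_combination:
  fixes n :: nat
  assumes x: "\<And>i. i < n \<Longrightarrow> x i \<in> X" and disj: "disjointly_supported M {..<n} x"
    and w: "\<And>i. cmod (w i) = 1"
  shows "N (\<lambda>t. \<Sum>k<n. w k * x k t) = N (\<lambda>t. \<Sum>k<n. x k t)"
proof -
  have mem: "(\<lambda>t. \<Sum>k<n. w k * x k t) \<in> X" "(\<lambda>t. \<Sum>k<n. x k t) \<in> X"
    using x by (auto intro!: sum_mem scale_mem)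
  have "AE t in M. cmod (\<Sum>k<n. w k * x k t) = cmod (\<Sum>k<n. x k t)"
    using disjointly_supported_AE[OF disj]
  proof eventually_elim
    case (elim t)
    then show ?case
    proof
      assume "\<exists>i<n. x i t \<noteq> 0 \<and> (\<forall>k<n. k \<noteq> i \<longrightarrow> x k t = 0)"
      then obtain i where i: "i < n" "\<And>k. k < n \<Longrightarrow> k \<noteq> i \<Longrightarrow> x k t = 0" by blast
      have "(\<Sum>k<n. w k * x k t) = w i * x i t" "(\<Sum>k<n. x k t) = x i t"
        using i by (auto intro!: sum_eq_single)
      then show ?thesis by (simp add: norm_mult w)
    qed simp
  qed
  then have "AE t in M. cmod (\<Sum>k<n. w k * x k t) \<le> cmod (\<Sum>k<n. x k t)"
    "AE t in M. cmod (\<Sum>k<n. x k t) \<le> cmod (\<Sum>k<n. w k * x k t)"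
    by (auto elim: eventually_mono)
  then show ?thesis
    using ideal[OF mem(1) measurable_mem[OF mem(2)]] ideal[OF mem(2) measurable_mem[OF mem(1)]]
    by fastforce
qed

text \<open>Averaging the defects \<open>\<K> (\<Sum> w\<^sub>k x\<^sub>k) - l (\<Sum> w\<^sub>k x\<^sub>k)\<close> over unimodular coefficients, after
  undoing the coefficients on the supports, replaces \<open>l\<close> by a map preserving the supports of the
  \<open>x\<^sub>k\<close>.\<close>

lemma trivial_log_bound:
  fixes n :: nat
  assumes WX: "W \<subseteq> X" and W: "complex_function_space W" and l: "linear_into_L0 M W l"
    and C: "C > 0"
    and triv: "\<And>x. x \<in> W \<Longrightarrow> (\<lambda>t. kalton_peck N x t - l x t) \<in> X"
      "\<And>x. x \<in> W \<Longrightarrow> N (\<lambda>t. kalton_peck N x t - l x t) \<le> C * N x"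
    and x: "\<And>i. i < n \<Longrightarrow> x i \<in> W" "\<And>i. i < n \<Longrightarrow> N (x i) \<le> 1"
    and disj: "disjointly_supported M {..<n} x"
    and s: "1 \<le> N (\<lambda>t. \<Sum>i<n. x i t)" (is "1 \<le> ?s")
  shows "?s * ln ?s \<le> C * ?s + C * M_param M N X n"
proof -
  interpret W: complex_function_space W by fact
  have "n > 0" using s norm_zero by (cases n) auto
  obtain w :: "nat \<Rightarrow> nat \<Rightarrow> complex" where "(\<forall>j i. cmod (w j i) = 1) \<and>
    (\<forall>i<n. \<forall>a. (\<Sum>j<n. cnj (w j i) * (\<Sum>k<n. w j k * a k)) = of_nat n * a i)"
    using unimodular_orthogonality[OF \<open>n > 0\<close>] by (rule exE)
  then have w: "\<And>j i. cmod (w j i) = 1"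
    and ortho: "\<And>i a. i < n \<Longrightarrow> (\<Sum>j<n. cnj (w j i) * (\<Sum>k<n. w j k * a k)) = of_nat n * a i"
    by simp_all
  have xX: "x i \<in> X" if "i < n" for i using x WX that by blast
  have AE1: "AE t in M. (\<forall>i<n. x i t = 0) \<or> (\<exists>i<n. x i t \<noteq> 0 \<and> (\<forall>k<n. k \<noteq> i \<longrightarrow> x k t = 0))"
    by (rule disjointly_supported_AE[OF disj])
  define S where "S j = (\<lambda>t. \<Sum>k<n. w j k * x k t)" for j
  have SW: "S j \<in> W" for j unfolding S_def by (auto intro!: W.sum_mem W.scale_mem x)
  \<comment> \<open>All recombinations have the norm of the plain sum, so the same denominator
    appears in the logarithm for every \<open>j\<close>.\<close>
  have NS: "N (S j) = ?s" for j
    unfolding S_def using xX disj w by (intro norm_unimodular_combination) auto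
  define B where "B j = (\<lambda>t. kalton_peck N (S j) t - l (S j) t)" for j
  have B: "B j \<in> X" "N (B j) \<le> C * ?s" for j
    using triv[OF SW[of j]] NS[of j] by (simp_all add: B_def)
  \<comment> \<open>Almost everywhere on the support of \<open>x i\<close>, \<open>m j\<close> is
    the conjugate of the coefficient \<open>w j i\<close>; off all supports it is 0.\<close>
  define m where "m j t = (\<Sum>i<n. if x i t \<noteq> 0 then cnj (w j i) else 0)" for j t
  have m_meas: "m j \<in> borel_measurable M" for j
    unfolding m_def[abs_def]
  proof (intro borel_measurable_sum)
    fix i assume "i \<in> {..<n}"
    then have [measurable]: "x i \<in> borel_measurable M" using measurable_mem[OF xX] by simp
    show "(\<lambda>t. if x i t \<noteq> 0 then cnj (w j i) else 0) \<in> borel_measurable M" by measurable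
  qed
  have m_eq: "m j t = cnj (w j i)"
    if "i < n" "x i t \<noteq> 0" "\<And>k. k < n \<Longrightarrow> k \<noteq> i \<Longrightarrow> x k t = 0" for j i t
    using that sum_eq_single[of i n "\<lambda>i. if x i t \<noteq> 0 then cnj (w j i) else 0"]
    by (simp add: m_def)
  have m_le: "AE t in M. cmod (m j t) \<le> 1" for j
    using AE1
  proof eventually_elim
    case (elim t)
    then show ?case
    proof
      assume "\<forall>i<n. x i t = 0"
      then show ?thesis by (simp add: m_def)
    next
      assume "\<exists>i<n. x i t \<noteq> 0 \<and> (\<forall>k<n. k \<noteq> i \<longrightarrow> x k t = 0)"
      then obtain i where "i < n" "x i t \<noteq> 0" "\<And>k. k < n \<Longrightarrow> k \<noteq> i \<Longrightarrow> x k t = 0" by blast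
      then show ?thesis using m_eq w by simp
    qed
  qed
  note mB = multiplier[OF B(1) m_meas m_le]
  \<comment> \<open>The averaged defect; on the support of \<open>x i\<close> it will equal
    \<open>x i * ln (cmod (x i) / ?s) - l (x i)\<close>.\<close>
  define b where "b = (\<lambda>t. complex_of_real (1 / n) * (\<Sum>j<n. m j t * B j t))"
  have sum_mB: "(\<lambda>t. \<Sum>j<n. m j t * B j t) \<in> X" using mB(1) by (intro sum_mem) auto
  have b: "b \<in> X" unfolding b_def by (rule scale_mem[OF sum_mB])
  have "N b = (1 / n) * N (\<lambda>t. \<Sum>j<n. m j t * B j t)"
    unfolding b_def using norm_scale[OF sum_mB, of "complex_of_real (1 / n)"] by (simp add: norm_divide)
  also have "\<dots> \<le> (1 / n) * (\<Sum>j<n. N (\<lambda>t. m j t * B j t))"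
    using mB(1) by (intro mult_left_mono norm_sum_le) auto
  also have "\<dots> \<le> (1 / n) * (\<Sum>j<n. C * ?s)"
    using mB(2) B(2) by (intro mult_left_mono sum_mono) (auto intro: order_trans)
  also have "\<dots> = C * ?s" using \<open>n > 0\<close> by simp
  finally have Nb: "N b \<le> C * ?s" .
  \<comment> \<open>The defect of \<open>x i\<close> is cut to the support of \<open>x i\<close> and
    divided by \<open>C\<close> to enter the unit ball. It need not lie in \<open>W\<close>, which
    is why the bound involves the parameter of \<open>X\<close>.\<close>
  define y where "y i = (\<lambda>t. (if x i t \<noteq> 0 then complex_of_real (1 / C) else 0) *
    (kalton_peck N (x i) t - l (x i) t))" for i
  have y: "y i \<in> X" "N (y i) \<le> 1" if i: "i < n" for i
  proof -
    let ?d = "\<lambda>t. kalton_peck N (x i) t - l (x i) t"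
    have d: "(\<lambda>t. complex_of_real (1 / C) * ?d t) \<in> X"
      using triv(1)[OF x(1)[OF i]] by (rule scale_mem)
    have [measurable]: "x i \<in> borel_measurable M" by (rule measurable_mem[OF xX[OF i]])
    have ind: "(\<lambda>t. if x i t \<noteq> 0 then 1 else 0 :: complex) \<in> borel_measurable M"
      by measurable
    have y_eq: "y i = (\<lambda>t. (if x i t \<noteq> 0 then 1 else 0) * (complex_of_real (1 / C) * ?d t))"
      by (auto simp: y_def fun_eq_iff)
    show "y i \<in> X" unfolding y_eq by (rule multiplier(1)[OF d ind]) simp
    have "N (y i) \<le> N (\<lambda>t. complex_of_real (1 / C) * ?d t)"
      unfolding y_eq by (rule multiplier(2)[OF d ind]) simp
    also have "\<dots> = (1 / C) * N ?d"
      using norm_scale[OF triv(1)[OF x(1)[OF i]], of "complex_of_real (1 / C)"] C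
      by (simp add: norm_divide)
    also have "\<dots> \<le> (1 / C) * (C * N (x i))"
      using C triv(2)[OF x(1)[OF i]] by (intro mult_left_mono) auto
    also have "\<dots> \<le> 1" using C x(2)[OF i] by simp
    finally show "N (y i) \<le> 1" .
  qed
  have y_disj: "disjointly_supported M {..<n} y"
    unfolding disjointly_supported_def
  proof (intro ballI impI)
    fix i j assume ij: "i \<in> {..<n}" "j \<in> {..<n}" "i \<noteq> j"
    then have "AE t in M. x i t = 0 \<or> x j t = 0"
      using disj by (simp add: disjointly_supported_def)
    then show "AE t in M. y i t = 0 \<or> y j t = 0"
      by eventually_elim (auto simp: y_def)
  qed
  define Y where "Y = (\<lambda>t. \<Sum>i<n. y i t)"
  have Y: "Y \<in> X" "N Y \<le> M_param M N X n"
    unfolding Y_def using y y_disj by (auto intro!: sum_mem M_param_ge)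
  have AE2: "AE t in M. \<forall>j\<in>{..<n}. l (S j) t = (\<Sum>k<n. w j k * l (x k) t)"
    unfolding S_def using x(1) by (intro AE_finite_allI finite_lessThan linear_into_L0_sum[OF W l]) auto
  \<comment> \<open>Almost everywhere, a nonzero \<open>x i\<close> has nonzero norm, so the default
    value of \<open>kalton_peck\<close> at norm 0 is avoided.\<close>
  have AE3: "AE t in M. \<forall>i\<in>{..<n}. N (x i) = 0 \<longrightarrow> x i t = 0"
  proof (intro AE_finite_allI finite_lessThan)
    fix i assume "i \<in> {..<n}"
    then show "AE t in M. N (x i) = 0 \<longrightarrow> x i t = 0"
      using norm_eq_0_iff[OF xX, of i] by (cases "N (x i) = 0") auto
  qed
  \<comment> \<open>In \<open>b - C Y\<close> the terms \<open>l (x i)\<close> and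
    \<open>ln (cmod (x i))\<close> cancel, leaving \<open>x i * (ln (N (x i)) - ln ?s)\<close>. As
    \<open>N (x i) \<le> 1 \<le> ?s\<close>, its modulus is at least that of
    \<open>ln ?s * x i\<close>.\<close>
  have key: "AE t in M. cmod (complex_of_real (ln ?s) * (\<Sum>i<n. x i t))
      \<le> cmod (b t + complex_of_real (- C) * Y t)"
    using AE1 AE2 AE3
  proof eventually_elim
    case (elim t)
    from elim(1) show ?case
    proof
      assume "\<forall>i<n. x i t = 0"
      then show ?thesis by simp
    next
      assume "\<exists>i<n. x i t \<noteq> 0 \<and> (\<forall>k<n. k \<noteq> i \<longrightarrow> x k t = 0)"
      then obtain i where i: "i < n" "x i t \<noteq> 0" "\<And>k. k < n \<Longrightarrow> k \<noteq> i \<Longrightarrow> x k t = 0" by blast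
      define L where "L = ln (cmod (x i t) / ?s)"
      define L' where "L' = ln (cmod (x i t) / N (x i))"
      \<comment> \<open>The coefficients of \<open>w j k\<close> in \<open>B j t\<close>. The other
        \<open>l (x k)\<close> need not vanish on the support of \<open>x i\<close>; orthogonality
        removes them.\<close>
      define a where "a k = (if k = i then x i t * complex_of_real L else 0) - l (x k) t" for k
      have "N (x i) \<noteq> 0" using elim(3) i by auto
      then have Nx: "N (x i) > 0" using norm_nonneg[OF xX[OF i(1)]] by simp
      have S_eq: "S j t = w j i * x i t" for j
        unfolding S_def using i by (intro sum_eq_single) auto
      have w0: "w j i \<noteq> 0" for j using w[of j i] by auto
      have "B j t = (\<Sum>k<n. w j k * a k)" if "j < n" for j
      proof -
        have "kalton_peck N (S j) t = w j i * (x i t * complex_of_real L)"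
          unfolding kalton_peck_def NS S_eq L_def using s i(2) w0 by (simp add: norm_mult w)
        moreover have "(\<Sum>k<n. w j k * (if k = i then x i t * complex_of_real L else 0))
            = w j i * (x i t * complex_of_real L)"
          using i(1) sum_eq_single[of i n "\<lambda>k. w j k * (if k = i then x i t * complex_of_real L else 0)"]
          by simp
        ultimately show ?thesis
          using elim(2) that by (simp add: B_def a_def right_diff_distrib sum_subtractf)
      qed
      then have "(\<Sum>j<n. m j t * B j t) = (\<Sum>j<n. cnj (w j i) * (\<Sum>k<n. w j k * a k))"
        using m_eq[OF i] by simp
      then have "b t = a i" using ortho[OF i(1), of a] \<open>n > 0\<close> by (simp add: b_def)
      then have b_eq: "b t = x i t * complex_of_real L - l (x i) t" by (simp add: a_def)
      have "Y t = y i t" unfolding Y_def using i by (intro sum_eq_single) (auto simp: y_def)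
      then have Y_eq: "complex_of_real C * Y t = x i t * complex_of_real L' - l (x i) t"
        using C i(2) \<open>N (x i) \<noteq> 0\<close> by (simp add: y_def kalton_peck_def L'_def)
      have "b t + complex_of_real (- C) * Y t = b t - complex_of_real C * Y t" by simp
      also have "\<dots> = x i t * complex_of_real (L - L')"
        unfolding b_eq Y_eq by (simp add: right_diff_distrib)
      finally have diff_eq: "b t + complex_of_real (- C) * Y t = x i t * complex_of_real (L - L')" .
      have "L - L' = ln (N (x i)) - ln ?s"
        using s Nx i(2) by (simp add: L_def L'_def ln_div)
      moreover have "ln (N (x i)) \<le> 0" using x(2)[OF i(1)] Nx by simp
      moreover have "ln ?s \<ge> 0" using s by simp
      ultimately have "ln ?s \<le> \<bar>L - L'\<bar>" and "\<bar>ln ?s\<bar> = ln ?s" by simp_all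
      then have "cmod (complex_of_real (ln ?s) * x i t) \<le> cmod (x i t * complex_of_real (L - L'))"
        unfolding norm_mult norm_of_real by (subst mult.commute) (simp add: mult_left_mono)
      moreover have "(\<Sum>i<n. x i t) = x i t" using i by (intro sum_eq_single) auto
      ultimately show ?thesis using diff_eq by simp
    qed
  qed
  have sX: "(\<lambda>t. \<Sum>i<n. x i t) \<in> X" using xX by (intro sum_mem) auto
  have CY: "(\<lambda>t. complex_of_real (- C) * Y t) \<in> X" by (rule scale_mem[OF Y(1)])
  have "?s * ln ?s = N (\<lambda>t. complex_of_real (ln ?s) * (\<Sum>i<n. x i t))"
    using norm_scale[OF sX, of "complex_of_real (ln ?s)"] s by simp
  also have "\<dots> \<le> N (\<lambda>t. b t + complex_of_real (- C) * Y t)"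
    using ideal[OF add_mem[OF b CY] measurable_mem[OF scale_mem[OF sX]] key] by simp
  also have "\<dots> \<le> N b + N (\<lambda>t. complex_of_real (- C) * Y t)" by (rule norm_triangle[OF b CY])
  also have "N (\<lambda>t. complex_of_real (- C) * Y t) = C * N Y"
    using norm_scale[OF Y(1), of "complex_of_real (- C)"] C by simp
  also have "N b + C * N Y \<le> C * ?s + C * M_param M N X n"
    using Nb Y(2) C by (intro add_mono mult_left_mono) auto
  finally show ?thesis .
qed

text \<open>A near-optimal disjoint sum in \<open>W\<close> has norm \<open>s > M_W(n) / 2\<close>,
  hence \<open>M_X(n) \<le> 2 R s\<close>. The logarithmic bound divided by \<open>s\<close> then
  reads \<open>ln s \<le> C + 2 C R\<close>, which bounds \<open>s\<close> and with it
  \<open>M_X(n)\<close>.\<close>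

lemma M_param_bounded_of_trivial:
  assumes WX: "W \<subseteq> X" and W: "complex_function_space W"
    and triv: "trivial_on M X N (kalton_peck N) W"
    and R: "R > 0" "\<forall>\<^sub>F n in sequentially. M_param M N X n \<le> R * M_param M N W n"
  shows "\<exists>B. \<forall>\<^sub>F n in sequentially. M_param M N X n \<le> B"
proof -
  interpret W: complex_function_space W by fact
  obtain l C0 where l: "linear_into_L0 M W l"
    and C0: "\<And>x. x \<in> W \<Longrightarrow> (\<lambda>t. kalton_peck N x t - l x t) \<in> X"
      "\<And>x. x \<in> W \<Longrightarrow> N (\<lambda>t. kalton_peck N x t - l x t) \<le> C0 * N x"
    using triv unfolding trivial_on_def by blast
  \<comment> \<open>\<open>trivial_log_bound\<close> divides by the constant, so it is made
    positive.\<close>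
  define C where "C = max C0 1"
  have C: "C > 0" by (simp add: C_def)
  have triv': "N (\<lambda>t. kalton_peck N x t - l x t) \<le> C * N x" if "x \<in> W" for x
  proof -
    have "C0 * N x \<le> C * N x"
      using norm_nonneg[of x] that WX by (intro mult_right_mono) (auto simp: C_def)
    then show ?thesis using C0(2)[OF that] by linarith
  qed
  define B where "B = 2 * R * exp (C + 2 * C * R)"
  have "M_param M N X n \<le> B" if n: "M_param M N X n \<le> R * M_param M N W n" for n
  proof (cases "M_param M N X n \<le> 2 * R")
    case True
    have "2 * R * 1 \<le> B" unfolding B_def using R C by (intro mult_left_mono) auto
    then show ?thesis using True by simp
  next
    case False
    let ?m = "M_param M N W n"
    \<comment> \<open>Beyond \<open>2 * R\<close> the parameter of \<open>W\<close> exceeds 2, so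
      half of it is still at least 1, as the logarithmic bound requires.\<close>
    have "R * 2 < R * ?m" using False n by linarith
    then have m: "?m > 2" using R by simp
    let ?E = "{N (\<lambda>t. \<Sum>i<n. x i t) | x.
      (\<forall>i<n. x i \<in> W \<and> N (x i) \<le> 1) \<and> disjointly_supported M {..<n} x}"
    have "N (\<lambda>t. \<Sum>i<n. 0) \<in> ?E"
      by (rule CollectI, rule exI[of _ "\<lambda>_ _. 0"])
        (simp add: W.zero_mem norm_zero disjointly_supported_def)
    moreover have "?m / 2 < Sup ?E" using m unfolding M_param_def by linarith
    ultimately have "\<exists>e\<in>?E. ?m / 2 < e"
      using less_cSup_iff[OF _ bdd_above_disjoint_sums[OF WX]] by blast
    then obtain x where x: "\<And>i. i < n \<Longrightarrow> x i \<in> W" "\<And>i. i < n \<Longrightarrow> N (x i) \<le> 1"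
      "disjointly_supported M {..<n} x" and s: "?m / 2 < N (\<lambda>t. \<Sum>i<n. x i t)" (is "_ < ?s")
      by blast
    have s1: "1 \<le> ?s" using s m by linarith
    have "?s * ln ?s \<le> C * ?s + C * M_param M N X n"
      by (rule trivial_log_bound[OF WX W l C C0(1) triv' x s1])
    also have "\<dots> \<le> C * ?s + C * (R * (2 * ?s))"
      using n s C R by (intro add_left_mono mult_left_mono order_trans[OF n]) auto
    also have "\<dots> = ?s * (C + 2 * C * R)" by (simp add: algebra_simps)
    finally have "ln ?s \<le> C + 2 * C * R" using s1 by simp
    then have "?s \<le> exp (C + 2 * C * R)" using s1 by (metis exp_le_cancel_iff exp_ln less_le_trans zero_less_one)
    then have "?m \<le> 2 * exp (C + 2 * C * R)" using s by linarith
    then have "R * ?m \<le> B" using R unfolding B_def by (simp add: mult.commute mult.left_commute)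
    then show ?thesis using n by linarith
  qed
  then show ?thesis by (intro exI[of _ B] eventually_mono[OF R(2)])
qed

text \<open>One unit vector is padded with zeros. This keeps the denominators positive when the
  parameters are compared.\<close>

lemma M_param_ge_one:
  assumes "Y \<subseteq> X" "(\<lambda>_. 0) \<in> Y" "v \<in> Y" "N v = 1" "n > 0"
  shows "1 \<le> M_param M N Y n"
proof -
  let ?x = "\<lambda>i::nat. if i = 0 then v else (\<lambda>_. 0)"
  have "N (\<lambda>t. \<Sum>i<n. ?x i t) \<le> M_param M N Y n"
    using assms by (intro M_param_ge) (auto simp: norm_zero disjointly_supported_def)
  moreover have "(\<Sum>i<n. ?x i t) = v t" for t
    using assms by (subst sum_eq_single[of 0]) auto
  ultimately show ?thesis using assms by simp
qed

section \<open>Disjoint sequences equivalent to the basis of \<open>c\<^sub>0\<close>\<close>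

lemma topological_dualI:
  assumes "\<And>x y. x \<in> X \<Longrightarrow> y \<in> X \<Longrightarrow> \<phi> (\<lambda>t. x t + y t) = \<phi> x + \<phi> y"
    and "\<And>c x. x \<in> X \<Longrightarrow> \<phi> (\<lambda>t. c * x t) = c * \<phi> x"
    and "\<And>x. x \<in> X \<Longrightarrow> cmod (\<phi> x) \<le> N x"
  shows "\<phi> \<in> topological_dual X N"
  using assms unfolding topological_dual_def by (auto intro!: exI[of _ 1])

lemma topological_dual_add:
  assumes "\<phi> \<in> topological_dual X N" "x \<in> X" "y \<in> X"
  shows "\<phi> (\<lambda>t. x t + y t) = \<phi> x + \<phi> y"
  using assms by (simp add: topological_dual_def)

lemma topological_dual_scale:
  assumes "\<phi> \<in> topological_dual X N" "x \<in> X"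
  shows "\<phi> (\<lambda>t. c * x t) = c * \<phi> x"
  using assms by (simp add: topological_dual_def)

lemma topological_dual_sum:
  fixes n :: nat
  assumes \<phi>: "\<phi> \<in> topological_dual X N" and x: "\<And>i. i < n \<Longrightarrow> x i \<in> X"
  shows "\<phi> (\<lambda>t. \<Sum>i<n. c i * x i t) = (\<Sum>i<n. c i * \<phi> (x i))"
  using x
proof (induction n)
  case 0
  show ?case using topological_dual_scale[OF \<phi> zero_closed, of 0] by simp
next
  case (Suc n)
  have mem: "(\<lambda>t. \<Sum>i<n. c i * x i t) \<in> X" "(\<lambda>t. c n * x n t) \<in> X" "x n \<in> X"
    using Suc.prems by (auto intro!: sum_mem scale_mem)
  then show ?case
    using Suc topological_dual_add[OF \<phi> mem(1,2)] topological_dual_scale[OF \<phi> mem(3)] by simp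
qed

lemma norm_le_dual_norm:
  assumes \<phi>: "\<phi> \<in> topological_dual X N" and f: "f \<in> X" and B: "N f \<le> B" "0 < B"
  shows "cmod (\<phi> f) \<le> B * dual_norm X N \<phi>"
proof -
  obtain C where C: "\<And>g. g \<in> X \<Longrightarrow> cmod (\<phi> g) \<le> C * N g"
    using \<phi> unfolding topological_dual_def by blast
  have bdd: "bdd_above ((\<lambda>g. cmod (\<phi> g)) ` {g \<in> X. N g \<le> 1})"
  proof (rule bdd_aboveI2)
    fix g assume "g \<in> {g \<in> X. N g \<le> 1}"
    then have g: "g \<in> X" "N g \<le> 1" by auto
    have "cmod (\<phi> g) \<le> C * N g" by (rule C[OF g(1)])
    also have "\<dots> \<le> \<bar>C\<bar> * 1"
      using g(2) norm_nonneg[OF g(1)] by (intro mult_mono) auto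
    finally show "cmod (\<phi> g) \<le> \<bar>C\<bar>" by simp
  qed
  let ?g = "\<lambda>t. complex_of_real (1 / B) * f t"
  have g: "?g \<in> X" by (rule scale_mem[OF f])
  have "N ?g \<le> 1"
    using norm_scale[OF f, of "complex_of_real (1 / B)"] B by (simp add: norm_divide)
  then have "cmod (\<phi> ?g) \<le> dual_norm X N \<phi>"
    unfolding dual_norm_def using g by (intro cSUP_upper bdd) blast
  moreover have "cmod (\<phi> ?g) = cmod (\<phi> f) / B"
    unfolding topological_dual_scale[OF \<phi> f] using B by (simp add: norm_divide)
  ultimately show ?thesis using B by (simp add: pos_divide_le_eq mult.commute)
qed

text \<open>Under the bound, \<open>v\<close> is equivalent to the unit vector basis of \<open>c\<^sub>0\<close>.  Its partial sums
  converge weakly* in the bidual; a weak limit in \<open>X\<close> would have to restrict to \<open>v k\<close> on the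
  support of each \<open>v k\<close>, but any functional seeing only these restrictions asymptotically
  vanishes on all \<open>v k\<close> and hence on the limit.\<close>

lemma c0_sequence_imp_not_reflexive:
  assumes v: "\<And>k. v k \<in> X" and Nv: "\<And>k. N (v k) = 1"
    and disj: "disjointly_supported M UNIV v"
    and bound: "\<forall>\<^sub>F n in sequentially. \<forall>c. (\<forall>k. cmod (c k) \<le> 1) \<longrightarrow> N (\<lambda>t. \<Sum>k<n. c k * v k t) \<le> B"
  shows "\<not> reflexive_space X N"
proof
  assume reflexive: "reflexive_space X N"
  let ?D = "topological_dual X N"
  \<comment> \<open>The weak* limit of the partial sums of \<open>v\<close>, as an element of the
    bidual.\<close>
  define \<Phi> where "\<Phi> \<phi> = (\<Sum>k. \<phi> (v k))" for \<phi> :: "('a \<Rightarrow> complex) \<Rightarrow> complex"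
  define B' where "B' = max B 1"
  obtain n0 where n0: "\<And>n c. n \<ge> n0 \<Longrightarrow> (\<And>k. cmod (c k) \<le> 1) \<Longrightarrow> N (\<lambda>t. \<Sum>k<n. c k * v k t) \<le> B'"
    using bound unfolding eventually_sequentially B'_def by (meson max.coboundedI1)
  have partial: "(\<Sum>k<n. cmod (\<phi> (v k))) \<le> B' * dual_norm X N \<phi>" if \<phi>: "\<phi> \<in> ?D" for \<phi> n
  proof -
    \<comment> \<open>These coefficients turn each term into its modulus, so the bound on
      combinations yields absolute summability.\<close>
    define c where "c k = (if \<phi> (v k) = 0 then 0 else complex_of_real (cmod (\<phi> (v k))) / \<phi> (v k))" for k
    \<comment> \<open>The bound holds only from \<open>n0\<close> on, so shorter sums are enlarged
      first.\<close>
    let ?m = "max n n0"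
    have c: "cmod (c k) \<le> 1" "c k * \<phi> (v k) = complex_of_real (cmod (\<phi> (v k)))" for k
      by (auto simp: c_def norm_divide)
    have "(\<Sum>k<n. cmod (\<phi> (v k))) \<le> (\<Sum>k<?m. cmod (\<phi> (v k)))"
      by (intro sum_mono2) auto
    also have "\<dots> = cmod (\<Sum>k<?m. c k * \<phi> (v k))"
      unfolding c(2) of_real_sum[symmetric] by (simp add: sum_nonneg del: of_real_sum)
    also have "\<dots> = cmod (\<phi> (\<lambda>t. \<Sum>k<?m. c k * v k t))"
      using topological_dual_sum[OF \<phi> v] by simp
    also have "\<dots> \<le> B' * dual_norm X N \<phi>"
      using n0[of ?m c] c(1) v
      by (intro norm_le_dual_norm[OF \<phi>]) (auto simp: B'_def intro!: sum_mem scale_mem)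
    finally show ?thesis .
  qed
  have summ: "summable (\<lambda>k. cmod (\<phi> (v k)))" if "\<phi> \<in> ?D" for \<phi>
    using partial[OF that] by (intro summableI_nonneg_bounded[where x = "B' * dual_norm X N \<phi>"]) auto
  have \<Phi>_bound: "cmod (\<Phi> \<phi>) \<le> B' * dual_norm X N \<phi>" if "\<phi> \<in> ?D" for \<phi>
  proof -
    have "cmod (\<Phi> \<phi>) \<le> (\<Sum>k. cmod (\<phi> (v k)))"
      unfolding \<Phi>_def by (rule summable_norm[OF summ[OF that]])
    also have "\<dots> \<le> B' * dual_norm X N \<phi>" by (rule suminf_le_const[OF summ[OF that] partial[OF that]])
    finally show ?thesis .
  qed
  note summ' = summable_norm_cancel[OF summ]
  have "\<Phi> \<in> topological_dual ?D (dual_norm X N)"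
    unfolding topological_dual_def[of ?D]
    using \<Phi>_bound by (auto simp: \<Phi>_def suminf_add[OF summ' summ', symmetric] suminf_mult[OF summ'])
  then obtain f where f: "f \<in> X" and \<Phi>_f: "\<And>\<phi>. \<phi> \<in> ?D \<Longrightarrow> \<Phi> \<phi> = \<phi> f"
    using reflexive unfolding reflexive_space_def by blast
  \<comment> \<open>The norm of the part on the support of \<open>v k\<close>; functionals dominated
    by \<open>q k\<close> see only that part.\<close>
  define q where "q k x = N (\<lambda>t. (if v k t \<noteq> 0 then 1 else 0) * x t)" for k x
  have meas: "(\<lambda>t. if v k t \<noteq> 0 then 1 else 0 :: complex) \<in> borel_measurable M" for k
  proof -
    have [measurable]: "v k \<in> borel_measurable M" by (rule measurable_mem[OF v])
    show ?thesis by measurable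
  qed
  have restrict: "(\<lambda>t. (if v k t \<noteq> 0 then 1 else 0) * x t) \<in> X" "q k x \<le> N x" if "x \<in> X" for k x
    unfolding q_def by (rule multiplier[OF that meas]; simp)+
  have q_nonneg: "0 \<le> q k x" if "x \<in> X" for k x
    unfolding q_def by (rule norm_nonneg[OF restrict(1)[OF that]])
  have q_add: "q k (\<lambda>t. x t + y t) \<le> q k x + q k y" if "x \<in> X" "y \<in> X" for k x y
    unfolding q_def using norm_triangle[OF restrict(1)[OF that(1)] restrict(1)[OF that(2)], of k k]
    by (simp add: distrib_left)
  have q_scale: "q k (\<lambda>t. c * x t) = cmod c * q k x" if "x \<in> X" for k c x
    unfolding q_def using norm_scale[OF restrict(1)[OF that], of c k] by (simp add: mult.left_commute)
  have q_v: "q j (v k) = (if j = k then 1 else 0)" for j k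
  proof (cases "j = k")
    case True
    then have "(\<lambda>t. (if v j t \<noteq> 0 then 1 else 0) * v k t) = v k" by auto
    then show ?thesis using True Nv by (simp add: q_def)
  next
    case False
    then have "AE t in M. v j t = 0 \<or> v k t = 0" using disj by (simp add: disjointly_supported_def)
    then have "AE t in M. (if v j t \<noteq> 0 then 1 else 0) * v k t = 0" by eventually_elim auto
    then show ?thesis using norm_eq_0_iff[OF restrict(1)[OF v]] False by (simp add: q_def)
  qed
  \<comment> \<open>A functional dominated by \<open>q j\<close> and equal to 1 in real part at
    \<open>v j\<close> kills every other \<open>v k\<close>. So its value under
    \<open>\<Phi>\<close> is its value at \<open>v j\<close>, which reflexivity transfers to
    \<open>f\<close>.\<close>
  have q_f: "1 \<le> q j f" for j
  proof -
    obtain \<phi> where \<phi>: "\<forall>x\<in>X. \<forall>y\<in>X. \<phi> (\<lambda>t. x t + y t) = \<phi> x + \<phi> y"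
      "\<forall>c. \<forall>x\<in>X. \<phi> (\<lambda>t. c * x t) = c * \<phi> x"
      "\<forall>x\<in>X. cmod (\<phi> x) \<le> q j x" "Re (\<phi> (v j)) = q j (v j)"
      using hahn_banach_seminorm[of "q j", OF q_add q_scale v] by blast
    have "\<phi> \<in> ?D" using \<phi> restrict(2) by (intro topological_dualI) (auto intro: order_trans)
    have zero: "\<phi> (v k) = 0" if "k \<noteq> j" for k
      using \<phi>(3) v[of k] q_v[of j k] that by force
    have "\<Phi> \<phi> = \<phi> (v j)"
      unfolding \<Phi>_def using suminf_finite[of "{j}" "\<lambda>k. \<phi> (v k)"] zero by simp
    then have "Re (\<phi> f) = 1" using \<Phi>_f[OF \<open>\<phi> \<in> ?D\<close>] \<phi>(4) q_v by simp
    then show ?thesis using \<phi>(3) f complex_Re_le_cmod[of "\<phi> f"] by fastforce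
  qed
  \<comment> \<open>The limsup ignores any finite number of supports. \<open>real_of_ereal\<close>
    sends infinite values to 0, so finiteness is checked next.\<close>
  define q' where "q' x = real_of_ereal (limsup (\<lambda>k. ereal (q k x)))" for x
  have q'_fin: "ereal (q' x) = limsup (\<lambda>k. ereal (q k x))" and q'_le: "q' x \<le> N x" if x: "x \<in> X" for x
  proof -
    have "limsup (\<lambda>k. ereal (q k x)) \<le> ereal (N x)"
      using restrict(2)[OF x] by (intro Limsup_bounded) auto
    moreover have "0 \<le> limsup (\<lambda>k. ereal (q k x))"
      using q_nonneg[OF x] by (intro le_Limsup) auto
    ultimately show "ereal (q' x) = limsup (\<lambda>k. ereal (q k x))" "q' x \<le> N x"
      unfolding q'_def by (cases "limsup (\<lambda>k. ereal (q k x))"; simp)+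
  qed
  have q'_add: "q' (\<lambda>t. x t + y t) \<le> q' x + q' y" if xy: "x \<in> X" "y \<in> X" for x y
  proof -
    have "ereal (q' (\<lambda>t. x t + y t)) \<le> limsup (\<lambda>k. ereal (q k x) + ereal (q k y))"
      unfolding q'_fin[OF add_mem[OF xy]] using q_add[OF xy] by (intro Limsup_mono) auto
    also have "\<dots> \<le> ereal (q' x) + ereal (q' y)"
      unfolding q'_fin[OF xy(1)] q'_fin[OF xy(2)] by (rule ereal_limsup_add_mono)
    finally show ?thesis by simp
  qed
  have q'_scale: "q' (\<lambda>t. c * x t) = cmod c * q' x" if x: "x \<in> X" for c x
  proof -
    have "ereal (q' (\<lambda>t. c * x t)) = limsup (\<lambda>k. ereal (cmod c) * ereal (q k x))"
      unfolding q'_fin[OF scale_mem[OF x]] by (simp add: q_scale[OF x])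
    also have "\<dots> = ereal (cmod c) * ereal (q' x)"
      unfolding q'_fin[OF x] by (rule limsup_ereal_mult_left) simp
    finally show ?thesis by simp
  qed
  \<comment> \<open>Only the index \<open>j = k\<close> contributes, and the limsup does not see
    it.\<close>
  have q'_v: "q' (v k) = 0" for k
  proof -
    have "limsup (\<lambda>j. ereal (q j (v k))) = limsup (\<lambda>j. 0)"
      using eventually_gt_at_top[of k] by (intro Limsup_eq) (auto simp: q_v elim: eventually_mono)
    then show ?thesis by (simp add: q'_def Limsup_const)
  qed
  \<comment> \<open>Dominated by \<open>q'\<close>, this functional vanishes on every
    \<open>v k\<close>, hence on \<open>f\<close> through \<open>\<Phi>\<close>; yet its real part
    at \<open>f\<close> is \<open>q' f\<close>, which \<open>q_f\<close> keeps at least 1.\<close>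
  obtain \<phi> where \<phi>: "\<forall>x\<in>X. \<forall>y\<in>X. \<phi> (\<lambda>t. x t + y t) = \<phi> x + \<phi> y"
    "\<forall>c. \<forall>x\<in>X. \<phi> (\<lambda>t. c * x t) = c * \<phi> x"
    "\<forall>x\<in>X. cmod (\<phi> x) \<le> q' x" "Re (\<phi> f) = q' f"
    using hahn_banach_seminorm[of q', OF q'_add q'_scale f] by blast
  have "\<phi> \<in> ?D" using \<phi> q'_le by (intro topological_dualI) (auto intro: order_trans)
  moreover have "\<phi> (v k) = 0" for k using \<phi>(3) v[of k] q'_v[of k] by force
  ultimately have "\<phi> f = 0" using \<Phi>_f[of \<phi>] by (simp add: \<Phi>_def)
  then have "q' f = 0" using \<phi>(4) by simp
  moreover have "ereal 1 \<le> limsup (\<lambda>k. ereal (q k f))"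
    using q_f by (intro le_Limsup) auto
  ultimately have "ereal 1 \<le> ereal 0" using q'_fin[OF f] by metis
  then show False by simp
qed

end

section \<open>Assembly: from a trivial restriction to a contradiction with reflexivity\<close>

theorem theorem5p4:
  fixes M :: "'a measure"
    and X :: "('a \<Rightarrow> complex) set"
    and N :: "('a \<Rightarrow> complex) \<Rightarrow> real"
    and p :: real
  assumes "p > 1"
    and "koethe_function_space M X N"
    and "reflexive_space X N"
    and "p_convex p X N"
    and "\<And>Y. disjointly_generated M X N Y \<Longrightarrow>
           asymp_equiv_bounds (M_param M N X) (M_param M N Y)"
  shows "disjointly_singular M X N (kalton_peck N)"
  unfolding disjointly_singular_def
proof (intro allI impI notI)
  fix W assume gen: "disjointly_generated M X N W" and triv: "trivial_on M X N (kalton_peck N) W"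
  interpret koethe_function_space M X N by fact
  obtain u where u: "\<And>k. u k \<in> X" "\<And>k. \<not> (AE t in M. u k t = 0)"
    and disj: "disjointly_supported M UNIV u" and W_eq: "W = closed_linear_span X N u"
    using gen unfolding disjointly_generated_def by blast
  have W: "complex_function_space W"
    unfolding W_eq by (rule complex_function_space_closed_linear_span[OF u(1)])
  then interpret W: complex_function_space W .
  have WX: "W \<subseteq> X" by (auto simp: W_eq closed_linear_span_def)
  \<comment> \<open>Normalization keeps the generators in \<open>W\<close> and puts their multiples
    by coefficients of modulus at most 1 into the unit ball.\<close>
  define v where "v k = (\<lambda>t. complex_of_real (1 / N (u k)) * u k t)" for k
  have Nu: "N (u k) > 0" for k
    using norm_nonneg[OF u(1)[of k]] norm_eq_0_iff[OF u(1)[of k]] u(2)[of k] by linarith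
  have v: "v k \<in> X" "N (v k) = 1" "v k \<in> W" for k
  proof -
    show "v k \<in> X" unfolding v_def by (rule scale_mem[OF u(1)])
    show "N (v k) = 1"
      unfolding v_def using norm_scale[OF u(1), of "complex_of_real (1 / N (u k))" k] Nu[of k]
      by (simp add: norm_divide)
    have "u k \<in> W" unfolding W_eq by (rule generator_mem_closed_linear_span[OF u(1)])
    then show "v k \<in> W" unfolding v_def by (rule W.scale_mem)
  qed
  \<comment> \<open>Scalars are included to cover \<open>v\<close> itself as well as the vectors
    \<open>c k * v k\<close>.\<close>
  have v_disj: "AE t in M. c * v i t = 0 \<or> d * v j t = 0" if "i \<noteq> j" for c d i j
  proof -
    have "AE t in M. u i t = 0 \<or> u j t = 0" using disj that by (simp add: disjointly_supported_def)
    then show ?thesis by eventually_elim (auto simp: v_def)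
  qed
  have "\<forall>\<^sub>F n in sequentially. 0 < M_param M N W n"
    using eventually_gt_at_top[of 0]
  proof eventually_elim
    case (elim n)
    then show ?case using M_param_ge_one[OF WX W.zero_mem v(3,2), of n] by linarith
  qed
  then obtain R where "R > 0" "\<forall>\<^sub>F n in sequentially. M_param M N X n \<le> R * M_param M N W n"
    using asymp_equiv_bounds_imp_le[OF assms(5)[OF gen]] by blast
  then obtain B where B: "\<forall>\<^sub>F n in sequentially. M_param M N X n \<le> B"
    using M_param_bounded_of_trivial[OF WX W triv] by blast
  \<comment> \<open>The vectors \<open>c k * v k\<close> compete in the supremum defining
    \<open>M_param\<close>, so its boundedness becomes the upper \<open>c0\<close> estimate.\<close>
  have sum_le: "N (\<lambda>t. \<Sum>k<n. c k * v k t) \<le> M_param M N X n" if "\<And>k. cmod (c k) \<le> 1" for c n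
    using that v v_disj
    by (intro M_param_ge) (auto simp: disjointly_supported_def norm_scale scale_mem)
  have "disjointly_supported M UNIV v"
    using v_disj[of _ _ 1 1] by (simp add: disjointly_supported_def)
  moreover have "\<forall>\<^sub>F n in sequentially. \<forall>c. (\<forall>k. cmod (c k) \<le> 1) \<longrightarrow> N (\<lambda>t. \<Sum>k<n. c k * v k t) \<le> B"
    using B
  proof eventually_elim
    case (elim n)
    show ?case
    proof (intro allI impI)
      fix c :: "nat \<Rightarrow> complex" assume "\<forall>k. cmod (c k) \<le> 1"
      then have "N (\<lambda>t. \<Sum>k<n. c k * v k t) \<le> M_param M N X n" by (intro sum_le) simp
      then show "N (\<lambda>t. \<Sum>k<n. c k * v k t) \<le> B" using elim by linarith
    qed
  qed
  ultimately have "\<not> reflexive_space X N"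
    by (rule c0_sequence_imp_not_reflexive[OF v(1,2)])
  then show False using assms(3) by contradiction
qed

end
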